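(* Let $K$ be a subcomplex of a finite simplicial complex $L$, let $k\ge 0$, and suppose $[\beta]_K\in \mathrm{H}^k(K)$ dies between $K$ and $L$. Then the death cochain from $K$ to $L$ does not depend on the representative for $[\beta]_K$: if $\beta_1,\beta_2$ are $k$-cocycles on $K$ with $[\beta_1]_K=[\beta_2]_K=[\beta]_K$, then the death cochain computed from $\beta_1$ equals the death cochain computed from $\beta_2$.
   Context: All simplicial complexes are finite and all (co)homology has real coefficients. $\mathrm{C}^k(X)$ is the space of real-valued functions on the set of $k$-simplices of $X$ (with orientations fixed), with inner product $\langle\alpha,\beta\rangle=\sum_\sigma \alpha(\sigma)\beta(\sigma)$ and norm $\|\cdot\|_2$; $\delta_X^k:\mathrm{C}^k(X)\to \mathrm{C}^{k+1}(X)$ is the coboundary operator, and $[\alpha]_X\in \mathrm{H}^k(X)$ is the class of a cocycle $\alpha$. For $\varphi\in \mathrm{C}^k(L)$, $\varphi|_K$ is its restriction to the $k$-simplices of $K$. A class $[\beta]_K\in \mathrm{H}^k(K)$ dies between $K$ and $L$ if $\beta$ cannot be extended to a $k$-cocycle on $L$. In that case the death cochain from $K$ to $L$ computed from the representative $\beta$ is $\delta_L^k\hat\beta$, where $\hat\beta$ is any element of $\operatorname{arg\,min}_{\beta'\in \mathrm{C}^k(L)}\{\|\delta_L^k\beta'\|_2 : \beta'|_K=\beta\}$ (the value $\delta_L^k\hat\beta$ is the same for all minimizers $\hat\beta$). *)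

theory Defs
  imports "HOL-Analysis.L2_Norm" "HOL-Combinatorics.Permutations"
begin

definition finite_simplicial_complex :: "'a set set \<Rightarrow> bool" where
  "finite_simplicial_complex X \<longleftrightarrow>
     finite X \<and> (\<forall>\<sigma>\<in>X. finite \<sigma> \<and> \<sigma> \<noteq> {}) \<and>
     (\<forall>\<sigma>\<in>X. \<forall>\<tau>. \<tau> \<subseteq> \<sigma> \<longrightarrow> \<tau> \<noteq> {} \<longrightarrow> \<tau> \<in> X)"

definition simplices :: "nat \<Rightarrow> 'a set set \<Rightarrow> 'a set set" where
  "simplices k X = {\<sigma> \<in> X. card \<sigma> = Suc k}"

text \<open>
  Orientations are chosen independently for every simplex, each by listing its vertices in
  some order; no compatibility between a simplex and its faces is required.  A subcomplex
  inherits the orientations of the ambient complex.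
\<close>

definition orientation :: "('a set \<Rightarrow> 'a list) \<Rightarrow> 'a set set \<Rightarrow> bool" where
  "orientation ori X \<longleftrightarrow> (\<forall>\<sigma>\<in>X. distinct (ori \<sigma>) \<and> set (ori \<sigma>) = \<sigma>)"

text \<open>
  A cochain is stored as a function on all sets that vanishes off the \<open>k\<close>-simplices,
  so that equality of cochains is equality of functions.
\<close>

definition cochains :: "nat \<Rightarrow> 'a set set \<Rightarrow> ('a set \<Rightarrow> real) set" where
  "cochains k X = {f. \<forall>\<sigma>. \<sigma> \<notin> simplices k X \<longrightarrow> f \<sigma> = 0}"

definition reorder_sign :: "'a list \<Rightarrow> 'a list \<Rightarrow> int" where
  "reorder_sign xs ys = sign (THE p. p permutes set xs \<and> map p xs = ys)"

text \<open>
  The alternating extension of \<open>f\<close> to ordered simplices: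
  \<open>f (v\<^sub>0,\<dots>,v\<^sub>k)\<close> is \<open>f {v\<^sub>0,\<dots>,v\<^sub>k}\<close> up to the sign comparing the
  given order of the vertices with the chosen orientation.
\<close>

definition on_ordered_simplex ::
    "('a set \<Rightarrow> 'a list) \<Rightarrow> ('a set \<Rightarrow> real) \<Rightarrow> 'a list \<Rightarrow> real" where
  "on_ordered_simplex ori f xs = of_int (reorder_sign xs (ori (set xs))) * f (set xs)"

definition omit_nth :: "nat \<Rightarrow> 'a list \<Rightarrow> 'a list" where
  "omit_nth i xs = take i xs @ drop (Suc i) xs"

definition coboundary ::
    "('a set \<Rightarrow> 'a list) \<Rightarrow> nat \<Rightarrow> 'a set set \<Rightarrow> ('a set \<Rightarrow> real) \<Rightarrow> 'a set \<Rightarrow> real" where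
  "coboundary ori k X f \<tau> =
     (if \<tau> \<in> simplices (Suc k) X
      then \<Sum>i\<le>Suc k. (-1) ^ i * on_ordered_simplex ori f (omit_nth i (ori \<tau>))
      else 0)"

definition cocycles ::
    "('a set \<Rightarrow> 'a list) \<Rightarrow> nat \<Rightarrow> 'a set set \<Rightarrow> ('a set \<Rightarrow> real) set" where
  "cocycles ori k X = {f \<in> cochains k X. coboundary ori k X f = (\<lambda>_. 0)}"

text \<open>Cohomology is unreduced: in degree \<open>0\<close> only the zero cochain is a coboundary.\<close>

definition coboundaries ::
    "('a set \<Rightarrow> 'a list) \<Rightarrow> nat \<Rightarrow> 'a set set \<Rightarrow> ('a set \<Rightarrow> real) set" where
  "coboundaries ori k X =
     (case k of 0 \<Rightarrow> {\<lambda>_. 0} | Suc j \<Rightarrow> coboundary ori j X ` cochains j X)"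

definition cohomology_class ::
    "('a set \<Rightarrow> 'a list) \<Rightarrow> nat \<Rightarrow> 'a set set \<Rightarrow> ('a set \<Rightarrow> real) \<Rightarrow> ('a set \<Rightarrow> real) set" where
  "cohomology_class ori k X \<alpha> =
     {\<alpha>' \<in> cocycles ori k X. (\<lambda>\<sigma>. \<alpha>' \<sigma> - \<alpha> \<sigma>) \<in> coboundaries ori k X}"

definition restrict_cochain ::
    "nat \<Rightarrow> 'a set set \<Rightarrow> ('a set \<Rightarrow> real) \<Rightarrow> 'a set \<Rightarrow> real" where
  "restrict_cochain k K f \<sigma> = (if \<sigma> \<in> simplices k K then f \<sigma> else 0)"

definition dies_between ::
    "('a set \<Rightarrow> 'a list) \<Rightarrow> nat \<Rightarrow> 'a set set \<Rightarrow> 'a set set \<Rightarrow> ('a set \<Rightarrow> real) \<Rightarrow> bool" where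
  "dies_between ori k K L \<beta> \<longleftrightarrow>
     \<not> (\<exists>\<phi> \<in> cocycles ori k L. restrict_cochain k K \<phi> = \<beta>)"

definition extends ::
    "nat \<Rightarrow> 'a set set \<Rightarrow> 'a set set \<Rightarrow> ('a set \<Rightarrow> real) \<Rightarrow> ('a set \<Rightarrow> real) \<Rightarrow> bool" where
  "extends k K L \<beta> \<beta>' \<longleftrightarrow> \<beta>' \<in> cochains k L \<and> restrict_cochain k K \<beta>' = \<beta>"

definition cochain_norm :: "nat \<Rightarrow> 'a set set \<Rightarrow> ('a set \<Rightarrow> real) \<Rightarrow> real" where
  "cochain_norm k X f = L2_set f (simplices k X)"

text \<open>
  \<open>arg_min\<close> picks some minimizer.  Below it is shown that one exists
  (\<open>ex_min_extension\<close>) and that every minimizer gives the same value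
  (\<open>death_cochain_eq\<close>).
\<close>

definition death_cochain ::
    "('a set \<Rightarrow> 'a list) \<Rightarrow> nat \<Rightarrow> 'a set set \<Rightarrow> 'a set set \<Rightarrow> ('a set \<Rightarrow> real) \<Rightarrow> 'a set \<Rightarrow> real" where
  "death_cochain ori k K L \<beta> =
     coboundary ori k L
       (arg_min (\<lambda>\<beta>'. cochain_norm (Suc k) L (coboundary ori k L \<beta>')) (extends k K L \<beta>))"

lemma coboundary_linear:
  "coboundary ori k X (\<lambda>\<sigma>. f \<sigma> + c * g \<sigma>) \<tau> =
     coboundary ori k X f \<tau> + c * coboundary ori k X g \<tau>"
  by (simp add: coboundary_def on_ordered_simplex_def sum_distrib_left distrib_left
      sum.distrib mult.left_commute del: sum.atMost_Suc)

lemma coboundary_sum: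
  assumes "finite I"
  shows "coboundary ori k X (\<lambda>\<sigma>. f \<sigma> + (\<Sum>i\<in>I. t i * g i \<sigma>)) \<tau> =
     coboundary ori k X f \<tau> + (\<Sum>i\<in>I. t i * coboundary ori k X (g i) \<tau>)"
  using assms
proof (induction I)
  case empty
  then show ?case by simp
next
  case (insert i I)
  have "coboundary ori k X (\<lambda>\<sigma>. f \<sigma> + (\<Sum>j\<in>insert i I. t j * g j \<sigma>)) \<tau>
      = coboundary ori k X (\<lambda>\<sigma>. (f \<sigma> + (\<Sum>j\<in>I. t j * g j \<sigma>)) + t i * g i \<sigma>) \<tau>"
    using insert.hyps by (simp add: algebra_simps)
  then show ?case
    using insert by (simp only: coboundary_linear) simp
qed

lemma ex_orthogonal_residual:
  fixes a :: "'i \<Rightarrow> 's \<Rightarrow> real" and c :: "'s \<Rightarrow> real"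
  assumes "finite I" "finite S"
  shows "\<exists>t. \<forall>j\<in>I. (\<Sum>s\<in>S. (c s + (\<Sum>i\<in>I. t i * a i s)) * a j s) = 0"
  using assms(1)
proof (induction I arbitrary: c)
  case empty
  then show ?case by simp
next
  case (insert i I)
  obtain t0 where t0: "\<forall>j\<in>I. (\<Sum>s\<in>S. (c s + (\<Sum>i\<in>I. t0 i * a i s)) * a j s) = 0"
    using insert.IH by blast
  obtain u where u: "\<forall>j\<in>I. (\<Sum>s\<in>S. (a i s + (\<Sum>i\<in>I. u i * a i s)) * a j s) = 0"
    using insert.IH by blast
  define r where "r s = c s + (\<Sum>i\<in>I. t0 i * a i s)" for s
  define q where "q s = a i s + (\<Sum>i\<in>I. u i * a i s)" for s
  define m where "m = - (\<Sum>s\<in>S. r s * q s) / (\<Sum>s\<in>S. q s * q s)"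
  define t where "t j = (if j = i then m else t0 j + m * u j)" for j
  have tI: "t j = t0 j + m * u j" if "j \<in> I" for j
    using that insert.hyps by (auto simp: t_def)
  have res: "c s + (\<Sum>j\<in>insert i I. t j * a j s) = r s + m * q s" for s
  proof -
    have "(\<Sum>j\<in>I. t j * a j s) = (\<Sum>j\<in>I. t0 j * a j s) + m * (\<Sum>j\<in>I. u j * a j s)"
      by (simp add: tI sum_distrib_left sum.distrib distrib_right mult.assoc)
    moreover have "t i = m" by (simp add: t_def)
    ultimately show ?thesis
      using insert.hyps by (simp add: r_def q_def algebra_simps)
  qed
  have orth: "(\<Sum>s\<in>S. (r s + m * q s) * a j s) = 0" if "j \<in> I" for j
  proof -
    have "(\<Sum>s\<in>S. (r s + m * q s) * a j s)
        = (\<Sum>s\<in>S. r s * a j s) + m * (\<Sum>s\<in>S. q s * a j s)"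
      by (simp add: sum_distrib_left algebra_simps sum.distrib)
    then show ?thesis using t0 u that by (simp add: r_def q_def)
  qed
  have "(\<Sum>s\<in>S. (r s + m * q s) * q s) = 0"
  proof (cases "(\<Sum>s\<in>S. q s * q s) = 0")
    case True
    then have "\<forall>s\<in>S. q s = 0"
      using assms(2) by (simp add: sum_nonneg_eq_0_iff)
    then show ?thesis by simp
  next
    case False
    have "(\<Sum>s\<in>S. (r s + m * q s) * q s) = (\<Sum>s\<in>S. r s * q s) + m * (\<Sum>s\<in>S. q s * q s)"
      by (simp add: sum_distrib_left algebra_simps sum.distrib)
    then show ?thesis using False by (simp add: m_def)
  qed
  moreover have "(\<Sum>s\<in>S. (r s + m * q s) * q s)
      = (\<Sum>s\<in>S. (r s + m * q s) * a i s) + (\<Sum>j\<in>I. u j * (\<Sum>s\<in>S. (r s + m * q s) * a j s))"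
  proof -
    have "(\<Sum>s\<in>S. (r s + m * q s) * q s)
        = (\<Sum>s\<in>S. (r s + m * q s) * a i s)
          + (\<Sum>s\<in>S. \<Sum>j\<in>I. u j * ((r s + m * q s) * a j s))"
      unfolding sum.distrib[symmetric]
      by (rule sum.cong) (simp_all add: q_def[of _] distrib_left sum_distrib_left mult.left_commute)
    also have "(\<Sum>s\<in>S. \<Sum>j\<in>I. u j * ((r s + m * q s) * a j s))
        = (\<Sum>j\<in>I. u j * (\<Sum>s\<in>S. (r s + m * q s) * a j s))"
      by (subst sum.swap) (simp add: sum_distrib_left)
    finally show ?thesis .
  qed
  ultimately have "(\<Sum>s\<in>S. (r s + m * q s) * a i s) = 0"
    using orth by simp
  then show ?case
    using orth by (intro exI[of _ t]) (simp add: res del: sum.insert)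
qed

lemma ex_pythagorean_extension:
  assumes L: "finite_simplicial_complex L" and "K \<subseteq> L" and \<beta>: "\<beta> \<in> cochains k K"
  obtains b where "extends k K L \<beta> b"
    and "\<And>b'. extends k K L \<beta> b' \<Longrightarrow>
      (\<Sum>\<tau>\<in>simplices (Suc k) L. (coboundary ori k L b' \<tau>)\<^sup>2) =
      (\<Sum>\<tau>\<in>simplices (Suc k) L. (coboundary ori k L b \<tau>)\<^sup>2) +
      (\<Sum>\<tau>\<in>simplices (Suc k) L. (coboundary ori k L b' \<tau> - coboundary ori k L b \<tau>)\<^sup>2)"
proof -
  let ?S = "simplices (Suc k) L" and ?d = "coboundary ori k L"
  define F where "F = simplices k L - simplices k K"
  define e where "e \<rho> \<sigma> = (if \<rho> = \<sigma> then 1 else 0 :: real)" for \<rho> \<sigma> :: "'a set"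
  have fin: "finite ?S" "finite F"
    using L by (auto simp: finite_simplicial_complex_def simplices_def F_def)
  have KL: "simplices k K \<subseteq> simplices k L"
    using \<open>K \<subseteq> L\<close> by (auto simp: simplices_def)
  have e: "(\<Sum>\<rho>\<in>F. t \<rho> * e \<rho> \<sigma>) = (if \<sigma> \<in> F then t \<sigma> else 0)" for t \<sigma>
    using fin by (simp add: e_def if_distrib[of "\<lambda>x. _ * x"] cong: if_cong)
  obtain t where t: "\<forall>\<rho>\<in>F. (\<Sum>\<tau>\<in>?S. (?d \<beta> \<tau> + (\<Sum>\<rho>\<in>F. t \<rho> * ?d (e \<rho>) \<tau>)) * ?d (e \<rho>) \<tau>) = 0"
    using ex_orthogonal_residual[OF fin(2,1), of "?d \<beta>" "\<lambda>\<rho>. ?d (e \<rho>)"] by blast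
  define b where "b \<sigma> = \<beta> \<sigma> + (\<Sum>\<rho>\<in>F. t \<rho> * e \<rho> \<sigma>)" for \<sigma>
  have "?d b \<tau> = ?d \<beta> \<tau> + (\<Sum>\<rho>\<in>F. t \<rho> * ?d (e \<rho>) \<tau>)" for \<tau>
    unfolding b_def by (rule coboundary_sum[OF fin(2)])
  with t have orth: "(\<Sum>\<tau>\<in>?S. ?d b \<tau> * ?d (e \<rho>) \<tau>) = 0" if "\<rho> \<in> F" for \<rho>
    using that by simp
  have b: "b \<sigma> = \<beta> \<sigma> + (if \<sigma> \<in> F then t \<sigma> else 0)" for \<sigma>
    by (simp add: b_def e)
  have ext: "extends k K L \<beta> b"
    using \<beta> KL by (auto simp: extends_def cochains_def restrict_cochain_def b F_def fun_eq_iff)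
  have "(\<Sum>\<tau>\<in>?S. (?d b' \<tau>)\<^sup>2) = (\<Sum>\<tau>\<in>?S. (?d b \<tau>)\<^sup>2) + (\<Sum>\<tau>\<in>?S. (?d b' \<tau> - ?d b \<tau>)\<^sup>2)"
    if b': "extends k K L \<beta> b'" for b'
  proof -
    have same: "b' \<sigma> = b \<sigma>" if "\<sigma> \<notin> F" for \<sigma>
    proof (cases "\<sigma> \<in> simplices k K")
      case True
      from b' ext have "restrict_cochain k K b' \<sigma> = restrict_cochain k K b \<sigma>"
        by (simp add: extends_def)
      with True show ?thesis by (simp add: restrict_cochain_def)
    next
      case False
      then show ?thesis
        using that b' ext by (auto simp: extends_def cochains_def F_def)
    qed
    have b'_eq: "b' = (\<lambda>\<sigma>. b \<sigma> + (\<Sum>\<rho>\<in>F. (b' \<rho> - b \<rho>) * e \<rho> \<sigma>))"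
      using same by (auto simp: e fun_eq_iff)
    have d: "?d b' \<tau> = ?d b \<tau> + (\<Sum>\<rho>\<in>F. (b' \<rho> - b \<rho>) * ?d (e \<rho>) \<tau>)" for \<tau>
      using arg_cong[OF b'_eq, of "\<lambda>f. ?d f \<tau>"]
        coboundary_sum[OF fin(2), of ori k L b "\<lambda>\<rho>. b' \<rho> - b \<rho>" e \<tau>]
      by (rule trans)
    have "(\<Sum>\<tau>\<in>?S. ?d b \<tau> * (?d b' \<tau> - ?d b \<tau>))
        = (\<Sum>\<tau>\<in>?S. \<Sum>\<rho>\<in>F. (b' \<rho> - b \<rho>) * (?d b \<tau> * ?d (e \<rho>) \<tau>))"
      by (rule sum.cong) (simp_all add: d sum_distrib_left mult.left_commute)
    also have "\<dots> = (\<Sum>\<rho>\<in>F. (b' \<rho> - b \<rho>) * (\<Sum>\<tau>\<in>?S. ?d b \<tau> * ?d (e \<rho>) \<tau>))"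
      by (subst sum.swap) (simp add: sum_distrib_left)
    finally have cross: "(\<Sum>\<tau>\<in>?S. ?d b \<tau> * (?d b' \<tau> - ?d b \<tau>)) = 0"
      using orth by simp
    have "(\<Sum>\<tau>\<in>?S. (?d b' \<tau>)\<^sup>2)
        = (\<Sum>\<tau>\<in>?S. (?d b \<tau>)\<^sup>2 + (?d b' \<tau> - ?d b \<tau>)\<^sup>2 + 2 * (?d b \<tau> * (?d b' \<tau> - ?d b \<tau>)))"
      by (rule sum.cong) (simp_all add: power2_eq_square algebra_simps)
    then show ?thesis
      using cross by (simp add: sum.distrib flip: sum_distrib_left)
  qed
  with ext show ?thesis by (rule that)
qed

lemma ex_min_extension:
  assumes "finite_simplicial_complex L" "K \<subseteq> L" "\<beta> \<in> cochains k K"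
  shows "\<exists>b. is_arg_min (\<lambda>\<beta>'. cochain_norm (Suc k) L (coboundary ori k L \<beta>')) (extends k K L \<beta>) b"
proof -
  obtain b where b: "extends k K L \<beta> b"
    and pyth: "\<And>b'. extends k K L \<beta> b' \<Longrightarrow>
      (\<Sum>\<tau>\<in>simplices (Suc k) L. (coboundary ori k L b' \<tau>)\<^sup>2) =
      (\<Sum>\<tau>\<in>simplices (Suc k) L. (coboundary ori k L b \<tau>)\<^sup>2) +
      (\<Sum>\<tau>\<in>simplices (Suc k) L. (coboundary ori k L b' \<tau> - coboundary ori k L b \<tau>)\<^sup>2)"
    by (rule ex_pythagorean_extension[OF assms, where ori = ori]) blast
  have "cochain_norm (Suc k) L (coboundary ori k L b) \<le> cochain_norm (Suc k) L (coboundary ori k L b')"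
    if "extends k K L \<beta> b'" for b'
    unfolding cochain_norm_def L2_set_def real_sqrt_le_iff pyth[OF that] by (simp add: sum_nonneg)
  with b show ?thesis
    unfolding is_arg_min_linorder by blast
qed

lemma death_cochain_eq:
  assumes L: "finite_simplicial_complex L" and "K \<subseteq> L" "\<beta> \<in> cochains k K"
    and min: "is_arg_min (\<lambda>\<beta>'. cochain_norm (Suc k) L (coboundary ori k L \<beta>')) (extends k K L \<beta>) b1"
  shows "death_cochain ori k K L \<beta> = coboundary ori k L b1"
proof -
  let ?S = "simplices (Suc k) L" and ?d = "coboundary ori k L"
  let ?min = "is_arg_min (\<lambda>\<beta>'. cochain_norm (Suc k) L (coboundary ori k L \<beta>')) (extends k K L \<beta>)"
  obtain b where b: "extends k K L \<beta> b"
    and pyth: "\<And>b'. extends k K L \<beta> b' \<Longrightarrow>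
      (\<Sum>\<tau>\<in>?S. (?d b' \<tau>)\<^sup>2) = (\<Sum>\<tau>\<in>?S. (?d b \<tau>)\<^sup>2) + (\<Sum>\<tau>\<in>?S. (?d b' \<tau> - ?d b \<tau>)\<^sup>2)"
    by (rule ex_pythagorean_extension[OF assms(1-3), where ori = ori]) blast
  have fin: "finite ?S"
    using L by (auto simp: finite_simplicial_complex_def simplices_def)
  have eq: "?d b' = ?d b" if "?min b'" for b'
  proof
    fix \<tau>
    have ext: "extends k K L \<beta> b'"
      and le: "(\<Sum>\<tau>\<in>?S. (?d b' \<tau>)\<^sup>2) \<le> (\<Sum>\<tau>\<in>?S. (?d b \<tau>)\<^sup>2)"
      using that b by (auto simp: is_arg_min_linorder cochain_norm_def L2_set_def)
    have "(\<Sum>\<tau>\<in>?S. (?d b' \<tau> - ?d b \<tau>)\<^sup>2) = 0"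
      using pyth[OF ext] le by (intro antisym sum_nonneg) auto
    then have "\<forall>\<tau>\<in>?S. ?d b' \<tau> = ?d b \<tau>"
      using fin by (simp add: sum_nonneg_eq_0_iff)
    then show "?d b' \<tau> = ?d b \<tau>"
      by (cases "\<tau> \<in> ?S") (auto simp: coboundary_def)
  qed
  have "?min (arg_min (\<lambda>\<beta>'. cochain_norm (Suc k) L (coboundary ori k L \<beta>')) (extends k K L \<beta>))"
    unfolding arg_min_def by (rule someI[of ?min, OF min])
  then show ?thesis
    using eq min by (simp add: death_cochain_def)
qed

end

theory Submission
  imports Defs
begin

text \<open>
  In degree \<open>0\<close> the representatives agree. Otherwise
  \<open>\<beta>1 - \<beta>2 = \<delta>\<^sub>K \<alpha>\<close> for some cochain \<open>\<alpha>\<close> on \<open>K\<close>, which extended by zero is a cochain on \<open>L\<close>;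
  subtracting \<open>\<delta>\<^sub>L \<alpha>\<close> maps the extensions of \<open>\<beta>1\<close> onto those of \<open>\<beta>2\<close>. As
  \<open>\<delta> \<circ> \<delta> = 0\<close>, this leaves the coboundaries of the extensions unchanged, so minimizers go to
  minimizers with the same coboundary. For \<open>\<delta> \<circ> \<delta> = 0\<close> with arbitrary orientations one needs that
  \<open>\<delta> f\<close> is given by the usual alternating sum for every ordering of a simplex; this reduces
  to the effect of deleting one vertex on the sign comparing two orderings.
\<close>

subsection \<open>Signs of reorderings\<close>

text \<open>A permutation that is the identity off \<open>set xs\<close> is determined by its values
  on \<open>xs\<close>, so any witness computes the definite description in
  \<open>reorder_sign\<close>.\<close>

lemma reorder_sign_eq:
  assumes "p permutes set xs" "map p xs = ys"
  shows "reorder_sign xs ys = sign p"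
proof -
  have "q = p" if "q permutes set xs" "map q xs = ys" for q
  proof
    fix x
    show "q x = p x"
    proof (cases "x \<in> set xs")
      case True
      then show ?thesis using that assms by (metis map_eq_conv)
    next
      case False
      then show ?thesis using that assms by (simp add: permutes_not_in)
    qed
  qed
  then have "(THE p. p permutes set xs \<and> map p xs = ys) = p"
    using assms by (intro the_equality) blast+
  then show ?thesis by (simp add: reorder_sign_def)
qed

text \<open>The entrywise assignment, extended by the identity, maps the finite set
  \<open>set xs\<close> onto itself and is therefore injective there.\<close>

lemma ex_reordering:
  assumes "distinct xs" "distinct ys" "set xs = set ys"
  obtains p where "p permutes set xs" "map p xs = ys"
proof -
  have len: "length xs = length ys"
    using assms by (metis distinct_card)
  define p where "p x = (if x \<in> set xs then the (map_of (zip xs ys) x) else x)" for x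
  have map: "map p xs = ys"
    using assms(1) len by (intro nth_equalityI) (auto simp: p_def map_of_zip_nth)
  then have "p ` set xs = set xs"
    using assms(3) by (metis set_map)
  then have "bij_betw p (set xs) (set xs)"
    by (simp add: bij_betw_def eq_card_imp_inj_on)
  then have "p permutes set xs"
    by (rule bij_imp_permutes) (simp add: p_def)
  with map show ?thesis by (rule that[rotated])
qed

text \<open>The two reordering permutations compose, and the sign is multiplicative. This permits
  detours through intermediate orderings.\<close>

lemma reorder_sign_trans:
  assumes "distinct xs" "distinct ys" "distinct zs" "set xs = set ys" "set ys = set zs"
  shows "reorder_sign xs zs = reorder_sign xs ys * reorder_sign ys zs"
proof -
  obtain p where p: "p permutes set xs" "map p xs = ys"
    using assms ex_reordering by metis
  obtain q where q: "q permutes set ys" "map q ys = zs"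
    using assms ex_reordering by metis
  have "map (q \<circ> p) xs = zs"
    using p(2) q(2) by (simp flip: map_map)
  moreover have "(q \<circ> p) permutes set xs"
    using p(1) q(1) assms(4) by (simp add: permutes_compose)
  ultimately have "reorder_sign xs zs = sign (q \<circ> p)"
    by (intro reorder_sign_eq)
  also have "\<dots> = sign q * sign p"
    using p(1) q(1) by (intro sign_compose permutation_permutes[THEN iffD2]) blast+
  finally show ?thesis
    by (simp add: reorder_sign_eq[OF p] reorder_sign_eq[OF q])
qed

lemma reorder_sign_refl: "reorder_sign xs xs = 1"
  using reorder_sign_eq[of id xs xs] by (simp add: permutes_id)

text \<open>By transitivity the two integers have product 1, so both are 1 or both are -1.\<close>

lemma reorder_sign_sym:
  assumes "distinct xs" "distinct ys" "set xs = set ys"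
  shows "reorder_sign xs ys = reorder_sign ys xs"
proof -
  have "reorder_sign xs ys * reorder_sign ys xs = 1"
    using reorder_sign_trans[OF assms(1,2,1) assms(3) assms(3)[symmetric]]
    by (simp add: reorder_sign_refl)
  then show ?thesis by (metis zmult_eq_1_iff)
qed

text \<open>The permutation between the tails fixes \<open>v\<close>, so it serves for the longer
  lists too.\<close>

lemma reorder_sign_Cons:
  assumes "distinct (v # xs)" "distinct (v # ys)" "set xs = set ys"
  shows "reorder_sign (v # xs) (v # ys) = reorder_sign xs ys"
proof -
  obtain p where p: "p permutes set xs" "map p xs = ys"
    using assms ex_reordering by (metis distinct.simps(2))
  have "map p (v # xs) = v # ys"
    using p assms by (simp add: permutes_not_in)
  moreover have "p permutes set (v # xs)"
    using p(1) by (rule permutes_subset) auto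
  ultimately show ?thesis
    using reorder_sign_eq[OF p] reorder_sign_eq by metis
qed

lemma reorder_sign_swap:
  assumes "distinct (v # w # xs)"
  shows "reorder_sign (v # w # xs) (w # v # xs) = - 1"
proof -
  have "map (transpose v w) (v # w # xs) = w # v # xs"
    using assms by (auto intro!: map_idI transpose_apply_other)
  moreover have "transpose v w permutes set (v # w # xs)"
    by (intro permutes_swap_id) auto
  ultimately show ?thesis
    using assms by (subst reorder_sign_eq) (auto simp: sign_swap_id)
qed

text \<open>The vertex \<open>v\<close> passes the entries of \<open>xs\<close> one at a time, each
  transposition costing a factor -1.\<close>

lemma reorder_sign_move_to_front:
  assumes "distinct (xs @ v # ys)"
  shows "reorder_sign (xs @ v # ys) (v # xs @ ys) = (- 1) ^ length xs"
  using assms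
proof (induction xs)
  case Nil
  then show ?case by (simp add: reorder_sign_refl)
next
  case (Cons w xs)
  have "reorder_sign (w # xs @ v # ys) (v # w # xs @ ys)
      = reorder_sign (w # xs @ v # ys) (w # v # xs @ ys)
        * reorder_sign (w # v # xs @ ys) (v # w # xs @ ys)"
    using Cons.prems by (intro reorder_sign_trans) auto
  also have "\<dots> = reorder_sign (xs @ v # ys) (v # xs @ ys) * - 1"
    using Cons.prems by (subst reorder_sign_Cons reorder_sign_swap, auto)+
  finally show ?case
    using Cons by simp
qed

subsection \<open>Omitting vertices\<close>

lemma length_omit_nth: "i < length xs \<Longrightarrow> length (omit_nth i xs) = length xs - 1"
  by (simp add: omit_nth_def)

lemma nth_omit_nth:
  assumes "i < length xs" "j < length xs - 1"
  shows "omit_nth i xs ! j = xs ! (if j < i then j else Suc j)"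
  using assms by (simp add: omit_nth_def nth_append)

lemma nth_split: "i < length xs \<Longrightarrow> xs = take i xs @ xs ! i # drop (Suc i) xs"
  by (simp add: id_take_nth_drop)

lemma distinct_nth_omit_nth:
  assumes "distinct xs" "i < length xs"
  shows "distinct (xs ! i # omit_nth i xs)"
proof -
  have "distinct (take i xs @ xs ! i # drop (Suc i) xs)"
    using assms by (simp flip: nth_split)
  then show ?thesis by (auto simp: omit_nth_def)
qed

lemma set_omit_nth:
  assumes "distinct xs" "i < length xs"
  shows "set (omit_nth i xs) = set xs - {xs ! i}"
proof -
  have "set xs = insert (xs ! i) (set (omit_nth i xs))"
    using arg_cong[OF nth_split[OF assms(2)], of set] by (auto simp: omit_nth_def)
  then show ?thesis
    using distinct_nth_omit_nth[OF assms] by auto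
qed

text \<open>Omitting position \<open>i\<close> shifts later entries down by one, so position
  \<open>j\<close> afterwards is position \<open>Suc j\<close> of \<open>xs\<close>. This simplicial
  identity pairs the terms of the double coboundary.\<close>

lemma omit_nth_omit_nth:
  assumes "i \<le> j" "Suc j < length xs"
  shows "omit_nth j (omit_nth i xs) = omit_nth i (omit_nth (Suc j) xs)"
proof (rule nth_equalityI)
  show "length (omit_nth j (omit_nth i xs)) = length (omit_nth i (omit_nth (Suc j) xs))"
    using assms by (simp add: length_omit_nth)
  fix l assume "l < length (omit_nth j (omit_nth i xs))"
  then have "l < length xs - 2"
    using assms by (simp add: length_omit_nth)
  then show "omit_nth j (omit_nth i xs) ! l = omit_nth i (omit_nth (Suc j) xs) ! l"
    using assms by (simp add: nth_omit_nth length_omit_nth)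
qed

text \<open>Move the common vertex to the front of both lists, at a cost of \<open>(- 1) ^ i\<close>
  and \<open>(- 1) ^ j\<close>. What remains compares two lists with the same head, which may be
  dropped.\<close>

lemma reorder_sign_omit_nth:
  assumes xs: "distinct xs" "i < length xs" and ys: "distinct ys" "j < length ys"
    and eq: "set xs = set ys" "xs ! i = ys ! j"
  shows "reorder_sign xs ys = (- 1) ^ (i + j) * reorder_sign (omit_nth i xs) (omit_nth j ys)"
proof -
  have front: "reorder_sign zs (zs ! l # omit_nth l zs) = (- 1) ^ l"
    if "distinct zs" "l < length zs" for zs :: "'a list" and l
    using reorder_sign_move_to_front[of "take l zs" "zs ! l" "drop (Suc l) zs"] that
    by (simp add: omit_nth_def min_def flip: nth_split)
  let ?x = "xs ! i # omit_nth i xs" and ?y = "xs ! i # omit_nth j ys"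
  note dx = distinct_nth_omit_nth[OF xs] and dy = distinct_nth_omit_nth[OF ys, folded eq(2)]
  have sx: "set ?x = set xs" and sy: "set ?y = set xs"
    using set_omit_nth[OF xs] set_omit_nth[OF ys] eq xs ys by (auto simp: insert_absorb)
  have so: "set (omit_nth i xs) = set (omit_nth j ys)"
    using set_omit_nth[OF xs] set_omit_nth[OF ys] eq by simp
  have "reorder_sign xs ys = reorder_sign xs ?x * reorder_sign ?x ys"
    by (rule reorder_sign_trans[OF xs(1) dx ys(1)]) (use sx eq in simp_all)
  also have "reorder_sign ?x ys = reorder_sign ?x ?y * reorder_sign ?y ys"
    by (rule reorder_sign_trans[OF dx dy ys(1)]) (use sx sy eq in simp_all)
  \<comment> \<open>\<open>front\<close> goes from \<open>ys\<close> to \<open>?y\<close>, so this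
    factor has to be reversed first.\<close>
  also have "reorder_sign ?y ys = reorder_sign ys ?y"
    by (rule reorder_sign_sym[OF dy ys(1)]) (use sy eq in simp)
  also have "reorder_sign ys ?y = (- 1) ^ j"
    using front[OF ys] eq(2) by simp
  also have "reorder_sign ?x ?y = reorder_sign (omit_nth i xs) (omit_nth j ys)"
    by (rule reorder_sign_Cons[OF dx dy so])
  finally show ?thesis
    by (simp add: front[OF xs] power_add)
qed

subsection \<open>The coboundary of a coboundary\<close>

lemma face_in_complex:
  assumes "finite_simplicial_complex X" "\<tau> \<in> simplices (Suc k) X" "v \<in> \<tau>"
  shows "\<tau> - {v} \<in> simplices k X"
proof -
  have "finite \<tau>" "card \<tau> = Suc (Suc k)"
    using assms by (auto simp: finite_simplicial_complex_def simplices_def)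
  then have card: "card (\<tau> - {v}) = Suc k"
    using assms(3) by simp
  have "\<tau> - {v} \<noteq> {}"
    using card by (metis card.empty nat.distinct(1))
  moreover have "\<tau> \<in> X"
    using assms(2) by (simp add: simplices_def)
  ultimately have "\<tau> - {v} \<in> X"
    using assms(1) Diff_subset[of \<tau> "{v}"] by (simp add: finite_simplicial_complex_def)
  with card show ?thesis by (simp add: simplices_def)
qed

lemma on_ordered_simplex_reorder:
  assumes "orientation ori X" "set xs \<in> X" "distinct xs" "distinct ys" "set xs = set ys"
  shows "on_ordered_simplex ori f xs = of_int (reorder_sign xs ys) * on_ordered_simplex ori f ys"
proof -
  have "distinct (ori (set ys))" "set (ori (set ys)) = set ys"
    using assms by (auto simp: orientation_def)
  then have "reorder_sign xs (ori (set ys)) = reorder_sign xs ys * reorder_sign ys (ori (set ys))"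
    using assms by (intro reorder_sign_trans) auto
  then show ?thesis
    using assms(5) by (simp add: on_ordered_simplex_def)
qed

text \<open>The definition of \<open>coboundary\<close> uses only the chosen ordering of a simplex.
  Passing to another ordering permutes the faces, and each summand changes by the same factor, the
  sign comparing the two orderings.\<close>

lemma on_ordered_simplex_coboundary:
  assumes X: "finite_simplicial_complex X" and ori: "orientation ori X"
    and xs: "distinct xs" "set xs \<in> simplices (Suc k) X"
  shows "on_ordered_simplex ori (coboundary ori k X f) xs =
    (\<Sum>i\<le>Suc k. (- 1) ^ i * on_ordered_simplex ori f (omit_nth i xs))"
proof -
  define ys where "ys = ori (set xs)"
  have ys: "distinct ys" "set ys = set xs"
    using ori xs by (auto simp: ys_def orientation_def simplices_def)
  have len: "length xs = Suc (Suc k)"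
    using xs distinct_card[of xs] by (simp add: simplices_def)
  have "mset xs = mset ys"
    using xs ys by (metis set_eq_iff_mset_eq_distinct)
  \<comment> \<open>Here \<open>p\<close> permutes positions, not vertices: entry \<open>i\<close>
    of \<open>xs\<close> is entry \<open>p i\<close> of \<open>ys\<close>.\<close>
  then obtain p where p: "p permutes {..<length ys}" "permute_list p ys = xs"
    using mset_eq_permutation by metis
  have len': "length ys = Suc (Suc k)"
    using p len by (metis length_permute_list)
  have pk: "p permutes {..Suc k}"
    using p(1) by (simp add: len' lessThan_Suc_atMost)
  have "of_int (reorder_sign xs ys) * ((- 1) ^ p i * on_ordered_simplex ori f (omit_nth (p i) ys))
      = (- 1) ^ i * on_ordered_simplex ori f (omit_nth i xs)" if "i \<le> Suc k" for i
  proof -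
    have i: "i < length xs" "p i < length ys"
      using that len len' permutes_in_image[OF pk, of i] by auto
    have nth: "xs ! i = ys ! p i"
      using p i len len' by (metis permute_list_nth)
    have sets: "set (omit_nth i xs) = set (omit_nth (p i) ys)"
      using set_omit_nth xs(1) ys i nth by metis
    have "set (omit_nth i xs) \<in> X"
      using face_in_complex[OF X xs(2), of "xs ! i"] set_omit_nth[OF xs(1) i(1)] i
      by (simp add: simplices_def)
    then have "on_ordered_simplex ori f (omit_nth i xs)
        = of_int (reorder_sign (omit_nth i xs) (omit_nth (p i) ys))
          * on_ordered_simplex ori f (omit_nth (p i) ys)"
      using distinct_nth_omit_nth[OF xs(1) i(1)] distinct_nth_omit_nth[OF ys(1) i(2)] sets
      by (intro on_ordered_simplex_reorder[OF ori]) simp_all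
    moreover have "reorder_sign xs ys
        = (- 1) ^ (i + p i) * reorder_sign (omit_nth i xs) (omit_nth (p i) ys)"
      using xs ys i nth by (intro reorder_sign_omit_nth) simp_all
    \<comment> \<open>The two factors \<open>(- 1) ^ p i\<close> cancel and leave
      \<open>(- 1) ^ i\<close>.\<close>
    ultimately show ?thesis
      by (simp add: power_add mult.assoc mult.left_commute flip: power_mult_distrib)
  qed
  then have "(\<Sum>i\<le>Suc k. (- 1) ^ i * on_ordered_simplex ori f (omit_nth i xs))
      = (\<Sum>i\<le>Suc k. of_int (reorder_sign xs ys)
          * ((- 1) ^ p i * on_ordered_simplex ori f (omit_nth (p i) ys)))"
    by (intro sum.cong) simp_all
  also have "\<dots> = (\<Sum>i\<le>Suc k. of_int (reorder_sign xs ys)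
          * ((- 1) ^ i * on_ordered_simplex ori f (omit_nth i ys)))"
    using sum.permute[OF pk, of "\<lambda>i. of_int (reorder_sign xs ys)
          * ((- 1) ^ i * on_ordered_simplex ori f (omit_nth i ys))"] by (simp only: o_def)
  also have "\<dots> = on_ordered_simplex ori (coboundary ori k X f) xs"
    using xs(2) by (simp add: on_ordered_simplex_def coboundary_def ys_def sum_distrib_left
        del: sum.atMost_Suc)
  finally show ?thesis ..
qed

lemma alternating_sum_omit_nth_omit_nth:
  fixes F :: "'a list \<Rightarrow> real"
  assumes "length xs = Suc (Suc n)"
  shows "(\<Sum>i\<le>Suc n. (- 1) ^ i * (\<Sum>j\<le>n. (- 1) ^ j * F (omit_nth j (omit_nth i xs)))) = 0"
proof -
  define g where "g = (\<lambda>(i, j). (- 1) ^ (i + j) * F (omit_nth j (omit_nth i xs)))"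
  \<comment> \<open>In \<open>A\<close> the vertex omitted second stands later in \<open>xs\<close>
    than the one omitted first; in \<open>B\<close> it stands earlier.\<close>
  define A where "A = {(i, j). i \<le> j \<and> j \<le> n}"
  define B where "B = {(i, j). j < i \<and> i \<le> Suc n}"
  have split: "{..Suc n} \<times> {..n} = A \<union> B" "A \<inter> B = {}"
    by (auto simp: A_def B_def)
  moreover have "finite (A \<union> B)"
    unfolding split(1)[symmetric] by simp
  ultimately have sum: "sum g ({..Suc n} \<times> {..n}) = sum g A + sum g B"
    by (simp add: sum.union_disjoint)
  \<comment> \<open>Omitting the same two vertices in the opposite order changes the index sum by
    one, hence the sign.\<close>
  have g: "g (i, j) = - g (j, i - 1)" if "j < i" "i \<le> Suc n" for i j
  proof (cases i)
    case (Suc l)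
    then show ?thesis
      using that assms by (simp add: g_def omit_nth_omit_nth add.commute)
  qed (use that in simp)
  have "sum g B = (\<Sum>x\<in>A. - g x)"
    by (rule sum.reindex_bij_witness[of _ "\<lambda>(i, j). (Suc j, i)" "\<lambda>(i, j). (j, i - 1)"])
      (auto simp: A_def B_def g)
  then have "sum g ({..Suc n} \<times> {..n}) = 0"
    using sum by (simp add: sum_negf)
  moreover have "sum g ({..Suc n} \<times> {..n})
      = (\<Sum>i\<le>Suc n. (- 1) ^ i * (\<Sum>j\<le>n. (- 1) ^ j * F (omit_nth j (omit_nth i xs))))"
    unfolding g_def sum.cartesian_product[symmetric] sum_distrib_left power_add mult.assoc ..
  ultimately show ?thesis by simp
qed

text \<open>A face inherits from \<open>ori \<tau>\<close> an ordering that may differ from its own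
  orientation. Evaluating the inner coboundary along the inherited ordering gives the double
  alternating sum that cancels.\<close>

lemma coboundary_coboundary:
  assumes X: "finite_simplicial_complex X" and ori: "orientation ori X"
  shows "coboundary ori (Suc k) X (coboundary ori k X f) \<tau> = 0"
proof (cases "\<tau> \<in> simplices (Suc (Suc k)) X")
  case True
  define xs where "xs = ori \<tau>"
  have xs: "distinct xs" "set xs = \<tau>"
    using ori True by (auto simp: xs_def orientation_def simplices_def)
  have len: "length xs = Suc (Suc (Suc k))"
    using True xs distinct_card[of xs] by (simp add: simplices_def)
  have "on_ordered_simplex ori (coboundary ori k X f) (omit_nth i xs)
      = (\<Sum>j\<le>Suc k. (- 1) ^ j * on_ordered_simplex ori f (omit_nth j (omit_nth i xs)))"
    if "i \<le> Suc (Suc k)" for i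
  proof (rule on_ordered_simplex_coboundary[OF X ori])
    have i: "i < length xs" using that len by simp
    show "distinct (omit_nth i xs)"
      using distinct_nth_omit_nth[OF xs(1) i] by simp
    show "set (omit_nth i xs) \<in> simplices (Suc k) X"
      using face_in_complex[OF X True, of "xs ! i"] set_omit_nth[OF xs(1) i] xs(2) nth_mem[OF i]
      by simp
  qed
  then have "coboundary ori (Suc k) X (coboundary ori k X f) \<tau> =
      (\<Sum>i\<le>Suc (Suc k). (- 1) ^ i *
        (\<Sum>j\<le>Suc k. (- 1) ^ j * on_ordered_simplex ori f (omit_nth j (omit_nth i xs))))"
    using True by (simp add: coboundary_def xs_def del: sum.atMost_Suc)
  also have "\<dots> = 0"
    using len by (rule alternating_sum_omit_nth_omit_nth)
  finally show ?thesis .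
qed (simp add: coboundary_def)

subsection \<open>Death cochains of cohomologous cocycles\<close>

lemma coboundary_diff:
  "coboundary ori k X (\<lambda>\<sigma>. f \<sigma> - g \<sigma>) \<tau> = coboundary ori k X f \<tau> - coboundary ori k X g \<tau>"
  using coboundary_linear[of ori k X f "-1" g] by simp

lemma zero_in_coboundaries: "(\<lambda>_. 0) \<in> coboundaries ori k X"
proof (cases k)
  case (Suc j)
  have "(\<lambda>_. 0) = coboundary ori j X (\<lambda>_. 0)"
    using coboundary_diff[of ori j X "\<lambda>_. 0" "\<lambda>_. 0"] by (simp add: fun_eq_iff)
  moreover have "(\<lambda>_. 0) \<in> cochains j X"
    by (simp add: cochains_def)
  ultimately show ?thesis
    by (simp add: coboundaries_def Suc)
qed (simp add: coboundaries_def)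

lemma diff_in_coboundaries:
  assumes "f \<in> coboundaries ori k X" "g \<in> coboundaries ori k X"
  shows "(\<lambda>\<sigma>. f \<sigma> - g \<sigma>) \<in> coboundaries ori k X"
proof (cases k)
  case (Suc j)
  then obtain a b where ab: "a \<in> cochains j X" "b \<in> cochains j X"
    "f = coboundary ori j X a" "g = coboundary ori j X b"
    using assms by (auto simp: coboundaries_def)
  then have "(\<lambda>\<sigma>. a \<sigma> - b \<sigma>) \<in> cochains j X"
    by (simp add: cochains_def)
  then show ?thesis
    unfolding ab Suc by (simp add: coboundaries_def flip: coboundary_diff)
qed (use assms in \<open>simp add: coboundaries_def\<close>)

lemma cohomology_class_eqD:
  assumes "\<alpha> \<in> cocycles ori k X" "cohomology_class ori k X \<alpha> = cohomology_class ori k X \<beta>"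
  shows "(\<lambda>\<sigma>. \<alpha> \<sigma> - \<beta> \<sigma>) \<in> coboundaries ori k X"
proof -
  have "\<alpha> \<in> cohomology_class ori k X \<alpha>"
    using assms(1) zero_in_coboundaries by (simp add: cohomology_class_def)
  then have "\<alpha> \<in> cohomology_class ori k X \<beta>"
    unfolding assms(2) .
  then show ?thesis by (simp add: cohomology_class_def)
qed

lemma extends_diff:
  assumes "extends k K L \<beta> b" "extends k K L \<gamma> c"
  shows "extends k K L (\<lambda>\<sigma>. \<beta> \<sigma> - \<gamma> \<sigma>) (\<lambda>\<sigma>. b \<sigma> - c \<sigma>)"
  using assms by (auto simp: extends_def cochains_def restrict_cochain_def)

lemma extends_add:
  assumes "extends k K L \<beta> b" "extends k K L \<gamma> c"
  shows "extends k K L (\<lambda>\<sigma>. \<beta> \<sigma> + \<gamma> \<sigma>) (\<lambda>\<sigma>. b \<sigma> + c \<sigma>)"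
  using assms by (auto simp: extends_def cochains_def restrict_cochain_def)

text \<open>Translation by the cocycle \<open>c\<close> matches the extensions of
  \<open>\<beta>\<close> with those of \<open>\<beta>\<close> minus \<open>\<gamma>\<close> and
  preserves their coboundaries, so minimizers correspond.\<close>

lemma death_cochain_diff:
  assumes L: "finite_simplicial_complex L" and K: "K \<subseteq> L"
    and \<beta>: "\<beta> \<in> cochains k K" and \<gamma>: "extends k K L \<gamma> c"
    and c: "coboundary ori k L c = (\<lambda>_. 0)"
  shows "death_cochain ori k K L (\<lambda>\<sigma>. \<beta> \<sigma> - \<gamma> \<sigma>) = death_cochain ori k K L \<beta>"
proof -
  let ?d = "coboundary ori k L"
  let ?min = "\<lambda>\<beta>. is_arg_min (\<lambda>\<beta>'. cochain_norm (Suc k) L (?d \<beta>')) (extends k K L \<beta>)"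
  obtain b where b: "?min \<beta> b"
    using ex_min_extension[OF L K \<beta>] by blast
  have d: "?d (\<lambda>\<sigma>. f \<sigma> - c \<sigma>) = ?d f" "?d (\<lambda>\<sigma>. f \<sigma> + c \<sigma>) = ?d f" for f
    using c coboundary_linear[of ori k L f 1 c] by (auto simp: coboundary_diff)
  have "?min (\<lambda>\<sigma>. \<beta> \<sigma> - \<gamma> \<sigma>) (\<lambda>\<sigma>. b \<sigma> - c \<sigma>)"
    unfolding is_arg_min_linorder
  proof (intro conjI allI impI)
    show "extends k K L (\<lambda>\<sigma>. \<beta> \<sigma> - \<gamma> \<sigma>) (\<lambda>\<sigma>. b \<sigma> - c \<sigma>)"
      using b \<gamma> by (intro extends_diff) (simp_all add: is_arg_min_def)
    \<comment> \<open>A competitor is translated back by \<open>c\<close>, where the minimality of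
      \<open>b\<close> applies.\<close>
    fix b' assume "extends k K L (\<lambda>\<sigma>. \<beta> \<sigma> - \<gamma> \<sigma>) b'"
    then have "extends k K L \<beta> (\<lambda>\<sigma>. b' \<sigma> + c \<sigma>)"
      using extends_add[OF _ \<gamma>, of "\<lambda>\<sigma>. \<beta> \<sigma> - \<gamma> \<sigma>" b'] by simp
    then have "cochain_norm (Suc k) L (?d b) \<le> cochain_norm (Suc k) L (?d (\<lambda>\<sigma>. b' \<sigma> + c \<sigma>))"
      using b unfolding is_arg_min_linorder by blast
    then show "cochain_norm (Suc k) L (?d (\<lambda>\<sigma>. b \<sigma> - c \<sigma>)) \<le> cochain_norm (Suc k) L (?d b')"
      by (simp add: d)
  qed
  moreover have "(\<lambda>\<sigma>. \<beta> \<sigma> - \<gamma> \<sigma>) \<in> cochains k K"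
    using \<beta> \<gamma> by (auto simp: extends_def cochains_def restrict_cochain_def)
  ultimately have "death_cochain ori k K L (\<lambda>\<sigma>. \<beta> \<sigma> - \<gamma> \<sigma>) = ?d (\<lambda>\<sigma>. b \<sigma> - c \<sigma>)"
    by (intro death_cochain_eq[OF L K])
  also have "\<dots> = death_cochain ori k K L \<beta>"
    using death_cochain_eq[OF L K \<beta> b] by (simp add: d)
  finally show ?thesis .
qed

lemma coboundary_extends_to_cocycle:
  assumes L: "finite_simplicial_complex L" and K: "K \<subseteq> L" and ori: "orientation ori L"
    and \<gamma>: "\<gamma> \<in> coboundaries ori k K"
  obtains c where "extends k K L \<gamma> c" "coboundary ori k L c = (\<lambda>_. 0)"
proof (cases k)
  case 0
  have "extends k K L \<gamma> (\<lambda>_. 0)"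
    using \<gamma> by (auto simp: 0 coboundaries_def extends_def cochains_def restrict_cochain_def)
  moreover have "coboundary ori k L (\<lambda>_. 0) = (\<lambda>_. 0)"
    using coboundary_diff[of ori k L "\<lambda>_. 0" "\<lambda>_. 0"] by (simp add: fun_eq_iff)
  ultimately show ?thesis by (rule that)
next
  case (Suc j)
  \<comment> \<open>Cochains are total functions vanishing off the simplices, so \<open>a\<close> is
    its own extension by zero to \<open>L\<close>. On simplices of \<open>K\<close> both
    coboundaries of \<open>a\<close> are given by the same formula.\<close>
  obtain a where a: "\<gamma> = coboundary ori j K a"
    using \<gamma> by (auto simp: Suc coboundaries_def)
  have "extends k K L \<gamma> (coboundary ori j L a)"
    using K by (auto simp: Suc a extends_def cochains_def restrict_cochain_def coboundary_def
        simplices_def fun_eq_iff)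
  moreover have "coboundary ori k L (coboundary ori j L a) = (\<lambda>_. 0)"
    using coboundary_coboundary[OF L ori] by (simp add: Suc fun_eq_iff)
  ultimately show ?thesis by (rule that)
qed

theorem corollary4p3:
  fixes K L :: "'a set set" and ori :: "'a set \<Rightarrow> 'a list" and k :: nat
    and \<beta> \<beta>1 \<beta>2 :: "'a set \<Rightarrow> real"
  assumes "finite_simplicial_complex L" and "finite_simplicial_complex K" and "K \<subseteq> L"
    and "orientation ori L"
    and "\<beta> \<in> cocycles ori k K" and "dies_between ori k K L \<beta>"
    and "\<beta>1 \<in> cocycles ori k K" and "\<beta>2 \<in> cocycles ori k K"
    and "cohomology_class ori k K \<beta>1 = cohomology_class ori k K \<beta>"
    and "cohomology_class ori k K \<beta>2 = cohomology_class ori k K \<beta>"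
  shows "death_cochain ori k K L \<beta>1 = death_cochain ori k K L \<beta>2"
proof -
  \<comment> \<open>This function is \<open>\<beta>1\<close> minus \<open>\<beta>2\<close>; taken as
    \<open>\<gamma>\<close> in \<open>death_cochain_diff\<close>, it turns \<open>\<beta>1\<close>
    into \<open>\<beta>2\<close>.\<close>
  have "(\<lambda>\<sigma>. (\<beta>1 \<sigma> - \<beta> \<sigma>) - (\<beta>2 \<sigma> - \<beta> \<sigma>)) \<in> coboundaries ori k K"
    using assms(7-10) by (intro diff_in_coboundaries cohomology_class_eqD)
  then obtain c where "extends k K L (\<lambda>\<sigma>. (\<beta>1 \<sigma> - \<beta> \<sigma>) - (\<beta>2 \<sigma> - \<beta> \<sigma>)) c"
    "coboundary ori k L c = (\<lambda>_. 0)"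
    by (rule coboundary_extends_to_cocycle[OF assms(1,3,4)])
  moreover have "\<beta>1 \<in> cochains k K"
    using assms(7) by (simp add: cocycles_def)
  ultimately show ?thesis
    using death_cochain_diff[OF assms(1,3)] by fastforce
qed

end
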